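(* Let $k,j$ be integers with $1\le j\le k$, and define $$S_{k,j}=\sum_{n_1=1}^{\infty}\cdots\sum_{n_k=1}^{\infty}\frac{n_1\cdots n_j}{(n_1+\cdots+n_k)!}.$$ Then $$S_{k,j}=e\sum_{i=0}^{j-1}\binom{j-1}{i}\frac{1}{(k+j-i-1)!},$$ and hence $S_{k,j}$ is a rational multiple of $e$. In particular, for every integer $k\ge 1$, $$\sum_{n_1=1}^{\infty}\cdots\sum_{n_k=1}^{\infty}\frac{n_1\cdots n_k}{(n_1+\cdots+n_k)!}=e\sum_{i=0}^{k-1}\binom{k-1}{i}\frac{1}{(2k-i-1)!}.$$
   Context: Here $e$ is Euler's number, $e=\sum_{n\ge 0}1/n!$. *)

theory Defs
  imports Complex_Main
begin

text \<open>
  The iterated series \<open>\<Sum>n\<^sub>1\<ge>1. \<dots> \<Sum>n\<^sub>k\<ge>1. f [n\<^sub>1, \<dots>, n\<^sub>k]\<close>, with \<open>n\<^sub>1\<close> outermost.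
  Library series start at 0, hence the shift by \<open>Suc\<close>.
\<close>

primrec iter_suminf :: "nat \<Rightarrow> (nat list \<Rightarrow> real) \<Rightarrow> real" where
  "iter_suminf 0 f = f []"
| "iter_suminf (Suc k) f = (\<Sum>n. iter_suminf k (\<lambda>ns. f (Suc n # ns)))"

text \<open>
  As \<^const>\<open>suminf\<close> is total, convergence is stated separately: every one of the
  nested series has to converge.
\<close>

primrec iter_summable :: "nat \<Rightarrow> (nat list \<Rightarrow> real) \<Rightarrow> bool" where
  "iter_summable 0 f \<longleftrightarrow> True"
| "iter_summable (Suc k) f \<longleftrightarrow>
     (\<forall>n. iter_summable k (\<lambda>ns. f (Suc n # ns))) \<and>
     summable (\<lambda>n. iter_suminf k (\<lambda>ns. f (Suc n # ns)))"

text \<open>Lists are indexed from 0, so \<open>ns ! 0, \<dots>, ns ! (j - 1)\<close> are \<open>n\<^sub>1, \<dots>, n\<^sub>j\<close>.\<close>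

definition S_term :: "nat \<Rightarrow> nat list \<Rightarrow> real" where
  "S_term j ns = (\<Prod>i<j. real (ns ! i)) / fact (sum_list ns)"

definition S :: "nat \<Rightarrow> nat \<Rightarrow> real" where
  "S k j = iter_suminf k (S_term j)"

end

theory Submission
  imports Defs
begin

text \<open>
  Put \<open>H r m = (\<Sum>N. (N + r - 1 choose N) / (m + N)!)\<close>. Pascal's rule gives
  \<open>H (r + 1) m - H (r + 1) (m + 1) = H r m\<close>, so summing telescopes:
  \<open>(\<Sum>n. H r (m + n)) = H (r + 1) m\<close> and, by Abel summation,
  \<open>(\<Sum>n. (n + 1) * H r (m + n)) = H (r + 2) m\<close>. As \<open>H 0 m = 1 / m!\<close>, evaluating the nested
  series from the inside out yields \<open>S k j = H (k + j) k\<close>, and Vandermonde's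
  identity splits this into multiples of the exponential series.
\<close>

section \<open>Convergence and size of the series \<open>H r m\<close>\<close>

lemma summable_binomial_div_fact:
  "summable (\<lambda>N. real ((N + r) choose N) / fact N)"
proof -
  \<comment> \<open>Each binomial coefficient is at most \<open>2 ^ (N + r)\<close>, so a multiple
    of the exponential series at 2 dominates.\<close>
  have s: "summable (\<lambda>N. 2 ^ r * (2 ^ N / fact N :: real))"
    using summable_exp_generic[of "2::real"]
    by (intro summable_mult) (simp add: divide_inverse mult.commute)
  show ?thesis
  proof (rule summable_comparison_test'[OF s, of 0])
    fix N :: nat
    have "(N + r) choose N \<le> 2 ^ (N + r)"
      by (rule binomial_le_pow2)
    then have "real ((N + r) choose N) \<le> 2 ^ (N + r)"
      by (metis of_nat_le_iff of_nat_numeral of_nat_power)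
    then show "norm (real ((N + r) choose N) / fact N) \<le> 2 ^ r * (2 ^ N / fact N)"
      by (simp add: power_add divide_simps mult.commute)
  qed
qed

text \<open>For \<open>r = 0\<close> truncated subtraction is intended: only the term \<open>N = 0\<close> survives.\<close>

definition binom_fact_sum :: "nat \<Rightarrow> nat \<Rightarrow> real" where
  "binom_fact_sum r m = (\<Sum>N. real ((N + r - 1) choose N) / fact (m + N))"

text \<open>Since \<open>m! * N!\<close> divides \<open>(m + N)!\<close>, the factor
  \<open>1 / m!\<close> splits off. What remains is a majorant free of \<open>m\<close>, which gives
  both convergence and decay in \<open>m\<close>.\<close>

lemma binom_fact_term_le:
  "real ((N + r - 1) choose N) / fact (m + N) \<le> (real ((N + r) choose N) / fact N) / fact m"
proof -
  have "(N + r - 1) choose N \<le> (N + r) choose N"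
    by (rule binomial_right_mono) simp
  moreover have "fact m * fact N \<le> (fact (m + N) :: real)"
  proof -
    have "fact m * fact N \<le> (fact (m + N) :: nat)"
      by (rule dvd_imp_le[OF fact_fact_dvd_fact]) simp
    then show ?thesis
      by (metis of_nat_fact of_nat_le_iff of_nat_mult)
  qed
  ultimately have "real ((N + r - 1) choose N) / fact (m + N)
      \<le> real ((N + r) choose N) / (fact m * fact N)"
    by (intro frac_le) auto
  then show ?thesis
    by (simp add: mult.commute)
qed

lemma summable_binom_fact_term:
  "summable (\<lambda>N. real ((N + r - 1) choose N) / fact (m + N))"
  by (rule summable_comparison_test'[OF summable_divide[OF summable_binomial_div_fact[of r]], of 0])
    (use binom_fact_term_le in simp)

lemma binom_fact_sum_nonneg: "0 \<le> binom_fact_sum r m"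
  unfolding binom_fact_sum_def by (intro suminf_nonneg summable_binom_fact_term) simp

lemma binom_fact_sum_le:
  "binom_fact_sum r m \<le> (\<Sum>N. real ((N + r) choose N) / fact N) / fact m"
  unfolding binom_fact_sum_def suminf_divide[OF summable_binomial_div_fact, symmetric]
  by (intro suminf_le binom_fact_term_le summable_binom_fact_term summable_divide
      summable_binomial_div_fact)

section \<open>Difference equation and telescoping sums\<close>

lemma binom_fact_sum_0: "binom_fact_sum 0 m = 1 / fact m"
proof -
  have "binom_fact_sum 0 m = (\<Sum>N\<in>{0}. real ((N + 0 - 1) choose N) / fact (m + N))"
    unfolding binom_fact_sum_def by (rule suminf_finite) (auto simp: binomial_eq_0)
  then show ?thesis
    by simp
qed

text \<open>Term \<open>N + 1\<close> of \<open>H (r + 1) m\<close> and term \<open>N\<close> of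
  \<open>H (r + 1) (m + 1)\<close> share the denominator \<open>(m + N + 1)!\<close>, so Pascal's
  rule applies termwise. The unmatched head \<open>1 / m!\<close> does not depend on
  \<open>r\<close> and is also the head of \<open>H r m\<close>.\<close>

lemma binom_fact_sum_diff:
  "binom_fact_sum (Suc r) m - binom_fact_sum (Suc r) (Suc m) = binom_fact_sum r m"
proof -
  let ?t = "\<lambda>r m N. real ((N + r - 1) choose N) / fact (m + N)"
  have pascal: "?t (Suc r) m (Suc N) - ?t (Suc r) (Suc m) N = ?t r m (Suc N)" for N
    by (simp add: diff_divide_distrib[symmetric])
  have head: "binom_fact_sum q m = 1 / fact m + (\<Sum>N. ?t q m (Suc N))" for q
    using suminf_split_head[OF summable_binom_fact_term[of q m]]
    by (simp add: binom_fact_sum_def)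
  have "(\<Sum>N. ?t (Suc r) m (Suc N)) - (\<Sum>N. ?t (Suc r) (Suc m) N) = (\<Sum>N. ?t r m (Suc N))"
    using suminf_diff[OF
        summable_binom_fact_term[of "Suc r" m, THEN summable_Suc_iff[THEN iffD2]]
        summable_binom_fact_term[of "Suc r" "Suc m"]]
    unfolding pascal .
  then show ?thesis
    using head[of r] head[of "Suc r"] binom_fact_sum_def[of "Suc r" "Suc m"] by simp
qed

text \<open>The factor \<open>n\<close> is there for the boundary term of the Abel summation
  below.\<close>

lemma binom_fact_sum_decay: "(\<lambda>n. real n * binom_fact_sum r (m + n)) \<longlonglongrightarrow> 0"
proof -
  define B where "B = (\<Sum>N. real ((N + r) choose N) / fact N)"
  have lim: "(\<lambda>n. B * (real n / fact n)) \<longlonglongrightarrow> 0"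
  proof -
    have "summable (\<lambda>n. 1 / fact n :: real)"
      using summable_exp[of "1::real"] by (simp add: divide_inverse)
    then have "(\<lambda>n. 1 / fact n :: real) \<longlonglongrightarrow> 0"
      by (rule summable_LIMSEQ_zero)
    moreover have "real (Suc n) / fact (Suc n) = 1 / fact n" for n
      by (simp add: divide_simps del: of_nat_Suc)
    ultimately have "(\<lambda>n. real (Suc n) / fact (Suc n)) \<longlonglongrightarrow> 0"
      by simp
    then have "(\<lambda>n. real n / fact n) \<longlonglongrightarrow> 0"
      by (simp only: filterlim_sequentially_Suc[where f = "\<lambda>n. real n / fact n"])
    then show ?thesis
      by (rule tendsto_mult_right_zero)
  qed
  have "0 \<le> B"
    unfolding B_def by (intro suminf_nonneg summable_binomial_div_fact) simp
  have "real n * binom_fact_sum r (m + n) \<le> B * (real n / fact n)" for n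
  proof -
    have "binom_fact_sum r (m + n) \<le> B / fact (m + n)"
      unfolding B_def by (rule binom_fact_sum_le)
    also have "\<dots> \<le> B / fact n"
      using \<open>0 \<le> B\<close> by (intro divide_left_mono fact_mono) auto
    finally show ?thesis
      using mult_left_mono[of _ _ "real n"] by (fastforce simp: mult.commute)
  qed
  then show ?thesis
    by (intro tendsto_sandwich[OF _ _ tendsto_const lim])
      (simp_all add: binom_fact_sum_nonneg)
qed

lemma binom_fact_sum_tendsto_0: "(\<lambda>n. binom_fact_sum r (m + n)) \<longlonglongrightarrow> 0"
proof (rule tendsto_sandwich[OF _ _ tendsto_const binom_fact_sum_decay[of r m]])
  show "\<forall>\<^sub>F n in sequentially. binom_fact_sum r (m + n) \<le> real n * binom_fact_sum r (m + n)"
    using eventually_ge_at_top[of 1]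
  proof eventually_elim
    case (elim n)
    then show ?case
      using mult_right_mono[OF _ binom_fact_sum_nonneg[of r "m + n"], of 1 "real n"] by simp
  qed
qed (simp add: binom_fact_sum_nonneg)

lemma sums_binom_fact_sum:
  "(\<lambda>n. binom_fact_sum r (m + n)) sums binom_fact_sum (Suc r) m"
  using telescope_sums'[OF binom_fact_sum_tendsto_0[of "Suc r" m]]
    binom_fact_sum_diff[of r "m + _"] by simp

lemma sums_weighted_binom_fact_sum:
  "(\<lambda>n. real (Suc n) * binom_fact_sum r (m + n)) sums binom_fact_sum (Suc (Suc r)) m"
proof -
  \<comment> \<open>A discrete antiderivative of the weighted terms: applying the difference
    equation at \<open>r\<close> and \<open>r + 1\<close> leaves
    \<open>u n - u (n + 1) = (n + 1) * H r (m + n)\<close>, and \<open>u 0\<close> is the claimed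
    sum.\<close>
  define u where
    "u n = real n * binom_fact_sum (Suc r) (m + n) + binom_fact_sum (Suc (Suc r)) (m + n)" for n
  have "u \<longlonglongrightarrow> 0"
    using tendsto_add[OF binom_fact_sum_decay[of "Suc r" m]
        binom_fact_sum_tendsto_0[of "Suc (Suc r)" m]]
    unfolding u_def by simp
  from telescope_sums'[OF this]
  have "(\<lambda>n. u n - u (Suc n)) sums u 0"
    by simp
  moreover have "u n - u (Suc n) = real (Suc n) * binom_fact_sum r (m + n)" for n
  proof -
    have "binom_fact_sum (Suc r) (m + Suc n) = binom_fact_sum (Suc r) (m + n) - binom_fact_sum r (m + n)"
      "binom_fact_sum (Suc (Suc r)) (m + Suc n) =
        binom_fact_sum (Suc (Suc r)) (m + n) - binom_fact_sum (Suc r) (m + n)"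
      using binom_fact_sum_diff[of r "m + n"] binom_fact_sum_diff[of "Suc r" "m + n"] by simp_all
    then show ?thesis
      unfolding u_def by (simp only: of_nat_Suc) (simp add: algebra_simps)
  qed
  ultimately show ?thesis
    by (simp add: u_def)
qed

section \<open>Evaluation of the nested series\<close>

text \<open>Fixing the outermost variable multiplies \<open>c\<close> by its weight, if it has one,
  and adds its value to \<open>m\<close>; hence the generalisation over both. Each summation raises
  the first index of \<open>H\<close> by 2 if weighted and by 1 otherwise, in total by
  \<open>k + j\<close>.\<close>

lemma iter_sum_prod_div_fact:
  assumes "j \<le> k"
  shows "iter_summable k (\<lambda>ns. c * (\<Prod>i<j. real (ns ! i)) / fact (m + sum_list ns)) \<and>
    iter_suminf k (\<lambda>ns. c * (\<Prod>i<j. real (ns ! i)) / fact (m + sum_list ns)) =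
      c * binom_fact_sum (k + j) (m + k)"
  using assms
proof (induction k arbitrary: j c m)
  case 0
  then show ?case
    by (simp add: binom_fact_sum_0)
next
  case (Suc k)
  show ?case
  proof (cases j)
    case 0
    have "(\<lambda>n. c * binom_fact_sum k (m + Suc n + k)) sums (c * binom_fact_sum (Suc k) (m + Suc k))"
      using sums_mult[OF sums_binom_fact_sum[of k "m + Suc k"], of c] by (simp add: ac_simps)
    then show ?thesis
      using 0 Suc.IH[of 0 c "m + Suc _"] by (simp add: ac_simps sums_iff)
  next
    \<comment> \<open>The outermost variable is weighted: its factor moves into \<open>c\<close>,
      and the remaining weights are reindexed from 0.\<close>
    case (Suc j')
    have "(\<lambda>n. c * real (Suc n) * binom_fact_sum (k + j') (m + Suc n + k)) sums
        (c * binom_fact_sum (Suc k + j) (m + Suc k))"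
      using sums_mult[OF sums_weighted_binom_fact_sum[of "k + j'" "m + Suc k"], of c] Suc
      by (simp add: ac_simps)
    moreover have "(\<lambda>ns. c * (\<Prod>i<j. real ((Suc n # ns) ! i)) / fact (m + sum_list (Suc n # ns))) =
        (\<lambda>ns. c * real (Suc n) * (\<Prod>i<j'. real (ns ! i)) / fact (m + Suc n + sum_list ns))" for n
      unfolding Suc prod.lessThan_Suc_shift by (simp add: ac_simps)
    moreover have "j' \<le> k"
      using Suc Suc.prems by simp
    ultimately show ?thesis
      using Suc.IH[of j' "c * real (Suc _)" "m + Suc _"]
      by (simp only: iter_summable.simps iter_suminf.simps sums_iff) blast
  qed
qed

section \<open>Closed form by Vandermonde's identity\<close>

lemma binom_fact_sum_closed_form:
  assumes "1 \<le> j"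
  shows "binom_fact_sum (k + j) k =
    exp 1 * (\<Sum>i=0..j-1. real ((j - 1) choose i) * (1 / fact (k + j - i - 1)))"
proof -
  have inner: "(\<lambda>N. real ((N + k) choose (k + d)) / fact (k + N)) sums (exp 1 / fact (k + d))"
    for d
  proof -
    let ?g = "\<lambda>N. real ((N + k) choose (k + d)) / fact (k + N)"
    \<comment> \<open>The numerator's \<open>(N + d + k)!\<close> cancels the denominator, leaving
      an exponential series. The terms before index \<open>d\<close> vanish, so the shift does not
      change the sum.\<close>
    have "?g (N + d) = 1 / fact N / fact (k + d)" for N
      using binomial_fact[of "k + d" "N + d + k", where ?'a = real]
      by (simp add: ac_simps divide_simps)
    moreover have "(\<lambda>N. 1 / fact N / fact (k + d)) sums (exp 1 / fact (k + d) :: real)"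
      using sums_divide[OF exp_converges[of "1::real"]] by (simp add: divide_inverse)
    ultimately have "(\<lambda>N. ?g (N + d)) sums (exp 1 / fact (k + d))"
      by simp
    moreover have "(\<Sum>N<d. ?g N) = 0"
      by (intro sum.neutral) (auto simp: binomial_eq_0)
    ultimately show ?thesis
      using sums_iff_shift[of ?g d "exp 1 / fact (k + d)"] by simp
  qed
  have split: "real ((N + (k + j) - 1) choose N) / fact (k + N) =
      (\<Sum>i=0..j-1. real ((j - 1) choose i) *
        (real ((N + k) choose (k + (j - 1 - i))) / fact (k + N)))" for N
  proof -
    \<comment> \<open>Reflecting the lower index makes it independent of \<open>N\<close>; the upper
      index is then split as \<open>(j - 1) + (N + k)\<close> for Vandermonde.\<close>
    have "(N + (k + j) - 1) choose N = ((j - 1) + (N + k)) choose (k + (j - 1))"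
      using assms binomial_symmetric[of N "N + (k + j) - 1"] by (simp add: ac_simps)
    also have "\<dots> = (\<Sum>i\<le>k + (j - 1). ((j - 1) choose i) * ((N + k) choose (k + (j - 1) - i)))"
      by (rule vandermonde[symmetric])
    also have "\<dots> = (\<Sum>i=0..j-1. ((j - 1) choose i) * ((N + k) choose (k + (j - 1) - i)))"
      by (intro sum.mono_neutral_right) (auto simp: binomial_eq_0)
    \<comment> \<open>As \<open>i\<close> is at most \<open>j - 1\<close>, the lower index has the
      form \<open>k + d\<close> with \<open>d = j - 1 - i\<close>, as \<open>inner\<close>
      requires.\<close>
    also have "\<dots> = (\<Sum>i=0..j-1. ((j - 1) choose i) * ((N + k) choose (k + (j - 1 - i))))"
      by (intro sum.cong refl) (simp del: diff_diff_left)
    finally show ?thesis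
      by (simp add: sum_divide_distrib)
  qed
  have "(\<lambda>N. real ((N + (k + j) - 1) choose N) / fact (k + N)) sums
      (\<Sum>i=0..j-1. real ((j - 1) choose i) * (exp 1 / fact (k + (j - 1 - i))))"
    unfolding split by (intro sums_sum sums_mult inner)
  then have "binom_fact_sum (k + j) k =
      (\<Sum>i=0..j-1. real ((j - 1) choose i) * (exp 1 / fact (k + (j - 1 - i))))"
    by (simp add: binom_fact_sum_def sums_iff)
  also have "\<dots> = (\<Sum>i=0..j-1. exp 1 * (real ((j - 1) choose i) * (1 / fact (k + j - i - 1))))"
  proof (intro sum.cong refl)
    fix i assume "i \<in> {0..j-1}"
    then have "k + (j - 1 - i) = k + j - i - 1"
      using assms by auto
    then show "real ((j - 1) choose i) * (exp 1 / fact (k + (j - 1 - i))) =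
        exp 1 * (real ((j - 1) choose i) * (1 / fact (k + j - i - 1)))"
      by simp
  qed
  finally show ?thesis
    by (simp add: sum_distrib_left)
qed

text \<open>A \<open>k\<close>-fold series evaluates its summand only at lists of length
  \<open>k\<close>. This is needed because \<open>prod_list\<close> agrees with the product over
  indices below \<open>k\<close> only under such a length restriction.\<close>

lemma iter_cong:
  assumes "\<And>ns. length ns = k \<Longrightarrow> f ns = g ns"
  shows "iter_suminf k f = iter_suminf k g \<and> iter_summable k f = iter_summable k g"
  using assms
proof (induction k arbitrary: f g)
  case (Suc k)
  have "iter_suminf k (\<lambda>ns. f (Suc n # ns)) = iter_suminf k (\<lambda>ns. g (Suc n # ns)) \<and>
      iter_summable k (\<lambda>ns. f (Suc n # ns)) = iter_summable k (\<lambda>ns. g (Suc n # ns))" for n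
    by (rule Suc.IH) (simp add: Suc.prems)
  then show ?case
    by simp
qed simp

theorem mainTheorem4:
  "(\<forall>k j :: nat. 1 \<le> j \<and> j \<le> k \<longrightarrow>
      iter_summable k (S_term j) \<and>
      S k j = exp 1 * (\<Sum>i=0..j-1. real ((j - 1) choose i) * (1 / fact (k + j - i - 1))) \<and>
      (\<exists>q\<in>\<rat>. S k j = q * exp 1)) \<and>
   (\<forall>k :: nat. 1 \<le> k \<longrightarrow>
      iter_summable k (\<lambda>ns. real (prod_list ns) / fact (sum_list ns)) \<and>
      iter_suminf k (\<lambda>ns. real (prod_list ns) / fact (sum_list ns)) =
        exp 1 * (\<Sum>i=0..k-1. real ((k - 1) choose i) * (1 / fact (2 * k - i - 1))))"
proof -
  let ?F = "\<lambda>k j. \<Sum>i=0..j-1. real ((j - 1) choose i) * (1 / fact (k + j - i - 1))"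
  have main: "iter_summable k (S_term j)" "S k j = exp 1 * ?F k j"
    if "1 \<le> j" "j \<le> k" for k j
    using iter_sum_prod_div_fact[OF that(2), of 1 0] binom_fact_sum_closed_form[OF that(1), of k]
    by (simp_all add: S_def S_term_def[abs_def])
  \<comment> \<open>The cofactor of \<open>exp 1\<close> is a finite sum of quotients of integers,
    so it serves as the rational witness.\<close>
  have rat: "?F k j \<in> \<rat>" for k j
  proof -
    have "(fact n :: real) \<in> \<rat>" for n
      by (metis Rats_of_nat of_nat_fact)
    then show ?thesis
      by (intro Rats_sum Rats_mult Rats_divide) auto
  qed
  have prod: "iter_suminf k (\<lambda>ns. real (prod_list ns) / fact (sum_list ns)) = S k k \<and>
      iter_summable k (\<lambda>ns. real (prod_list ns) / fact (sum_list ns)) = iter_summable k (S_term k)"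
    for k
    unfolding S_def
    by (rule iter_cong) (simp add: S_term_def prod.list_conv_set_nth atLeast0LessThan)
  show ?thesis
  proof (intro conjI allI impI)
    fix k j :: nat
    assume "1 \<le> j \<and> j \<le> k"
    then show "iter_summable k (S_term j)" "S k j = exp 1 * ?F k j"
      "\<exists>q\<in>\<rat>. S k j = q * exp 1"
      using main[of j k] rat[of j k] by (auto simp: mult.commute)
  next
    fix k :: nat
    assume "1 \<le> k"
    then show "iter_summable k (\<lambda>ns. real (prod_list ns) / fact (sum_list ns))"
      "iter_suminf k (\<lambda>ns. real (prod_list ns) / fact (sum_list ns)) =
        exp 1 * (\<Sum>i=0..k-1. real ((k - 1) choose i) * (1 / fact (2 * k - i - 1)))"
      using main[of k k] prod[of k] by (simp_all add: mult_2)
  qed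
qed

end
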